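(* Let $\epsilon,\delta,\alpha>0$. There exists an identity tester $T$ such that the following procedure is an $(\epsilon,\delta)$-aDP full-information property tester with query complexity $O\left(\frac{\sqrt n}{\alpha^2}\right)$ and proximity parameter $\alpha$: given the side information $(Q_0,Q_1)$, if $(Q_0,Q_1)$ is not $(\epsilon,\delta)$-aDP, output REJECT; otherwise run $T$ on $(Q_0,x)$ with $x\sim P_0^r$ and on $(Q_1,x)$ with $x\sim P_1^r$, where $r$ is the sample complexity of $T$; output REJECT if at least one of the two runs rejects, and ACCEPT otherwise.
   Context: An algorithm in the two-database setting is a pair $\mathcal{A}=(P_0,P_1)$ of probability distributions on $[n]=\{1,\dots,n\}$: it accepts two (neighbouring) databases $0,1$, and querying database $i$ returns an independent sample from $P_i$; $P^r$ denotes $r$ independent copies of $P$. A pair $(P_0,P_1)$ is $(\epsilon,\delta)$-aDP (approximate differentially private) if $P_0(E)\le e^\epsilon P_1(E)+\delta$ and $P_1(E)\le e^\epsilon P_0(E)+\delta$ for all events $E$. It is $\alpha$-far from $(\epsilon,\delta)$-aDP if $|\delta'-\delta|>\alpha$ for every $\delta'$ such that it is $(\epsilon,\delta')$-aDP. A full-information (FI) $(\epsilon,\delta)$-aDP property tester with proximity parameter $\alpha$ and query complexity $r$ per database is given an explicit (untrusted) pair of distributions $(Q_0,Q_1)$ on $[n]$ as side information and $r$ independent samples from each of the unknown $P_0,P_1$; it ACCEPTS with probability at least $2/3$ if $(P_0,P_1)$ is $(\epsilon,\delta)$-aDP and $P_0=Q_0$, $P_1=Q_1$, and REJECTS with probability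 at least $2/3$ if $(P_0,P_1)$ is $\alpha$-far from $(\epsilon,\delta)$-aDP. An identity tester $T$ with sample complexity $r$ takes as input a description of a discrete distribution $P$ on $[n]$ and $r$ independent samples from a distribution $Q$ on $[n]$; if $P=Q$ it ACCEPTS with probability at least $2/3$, and if $\|P-Q\|_{\mathrm{TV}}=\sup_E|P(E)-Q(E)|\ge\alpha$ it REJECTS with probability at least $2/3$. *)

theory Defs
  imports "HOL-Probability.Probability"
begin

text \<open>A distribution on \<open>[n] = {1,\<dots>,n}\<close> is a pmf on the naturals supported in \<open>{1..n}\<close>.\<close>

definition dist_on :: "nat \<Rightarrow> nat pmf \<Rightarrow> bool" where
  "dist_on n P \<longleftrightarrow> set_pmf P \<subseteq> {1..n}"

text \<open>Events range over all subsets of the type; for distributions on \<open>[n]\<close> this is the same as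
  ranging over subsets of \<open>{1..n}\<close>.\<close>

definition aDP :: "real \<Rightarrow> real \<Rightarrow> 'a pmf \<Rightarrow> 'a pmf \<Rightarrow> bool" where
  "aDP \<epsilon> \<delta> P0 P1 \<longleftrightarrow>
     (\<forall>E. measure_pmf.prob P0 E \<le> exp \<epsilon> * measure_pmf.prob P1 E + \<delta> \<and>
          measure_pmf.prob P1 E \<le> exp \<epsilon> * measure_pmf.prob P0 E + \<delta>)"

definition far_from_aDP :: "real \<Rightarrow> real \<Rightarrow> real \<Rightarrow> 'a pmf \<Rightarrow> 'a pmf \<Rightarrow> bool" where
  "far_from_aDP \<alpha> \<epsilon> \<delta> P0 P1 \<longleftrightarrow> (\<forall>\<delta>'. aDP \<epsilon> \<delta>' P0 P1 \<longrightarrow> \<bar>\<delta>' - \<delta>\<bar> > \<alpha>)"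

definition tv_dist :: "'a pmf \<Rightarrow> 'a pmf \<Rightarrow> real" where
  "tv_dist P Q = (SUP E. \<bar>measure_pmf.prob P E - measure_pmf.prob Q E\<bar>)"

datatype verdict = Accept | Reject

text \<open>Testers may be randomized: on given inputs they return a distribution over verdicts.
  An identity-testing algorithm gets the description of a distribution and a list of samples; a
  full-information algorithm gets the side information \<open>(Q\<^sub>0, Q\<^sub>1)\<close> and the two lists of samples
  obtained by querying the two databases.\<close>

type_synonym identity_alg = "nat pmf \<Rightarrow> nat list \<Rightarrow> verdict pmf"
type_synonym fi_alg = "nat pmf \<Rightarrow> nat pmf \<Rightarrow> nat list \<Rightarrow> nat list \<Rightarrow> verdict pmf"

definition run_identity :: "nat \<Rightarrow> identity_alg \<Rightarrow> nat pmf \<Rightarrow> nat pmf \<Rightarrow> verdict pmf" where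
  "run_identity r T P Q = do {x \<leftarrow> replicate_pmf r Q; T P x}"

definition run_fi ::
  "nat \<Rightarrow> fi_alg \<Rightarrow> nat pmf \<Rightarrow> nat pmf \<Rightarrow> nat pmf \<Rightarrow> nat pmf \<Rightarrow> verdict pmf" where
  "run_fi r A Q0 Q1 P0 P1 =
     do {x0 \<leftarrow> replicate_pmf r P0; x1 \<leftarrow> replicate_pmf r P1; A Q0 Q1 x0 x1}"

definition identity_tester :: "nat \<Rightarrow> real \<Rightarrow> nat \<Rightarrow> identity_alg \<Rightarrow> bool" where
  "identity_tester n \<alpha> r T \<longleftrightarrow>
     (\<forall>P Q. dist_on n P \<longrightarrow> dist_on n Q \<longrightarrow>
        (P = Q \<longrightarrow> pmf (run_identity r T P Q) Accept \<ge> 2/3) \<and>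
        (tv_dist P Q \<ge> \<alpha> \<longrightarrow> pmf (run_identity r T P Q) Reject \<ge> 2/3))"

definition fi_aDP_tester ::
  "nat \<Rightarrow> real \<Rightarrow> real \<Rightarrow> real \<Rightarrow> nat \<Rightarrow> fi_alg \<Rightarrow> bool" where
  "fi_aDP_tester n \<epsilon> \<delta> \<alpha> r A \<longleftrightarrow>
     (\<forall>Q0 Q1 P0 P1. dist_on n Q0 \<longrightarrow> dist_on n Q1 \<longrightarrow> dist_on n P0 \<longrightarrow> dist_on n P1 \<longrightarrow>
        (aDP \<epsilon> \<delta> P0 P1 \<and> P0 = Q0 \<and> P1 = Q1 \<longrightarrow>
           pmf (run_fi r A Q0 Q1 P0 P1) Accept \<ge> 2/3) \<and>
        (far_from_aDP \<alpha> \<epsilon> \<delta> P0 P1 \<longrightarrow>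
           pmf (run_fi r A Q0 Q1 P0 P1) Reject \<ge> 2/3))"

text \<open>The two runs of \<open>T\<close> use independent internal randomness.\<close>

definition fi_procedure :: "real \<Rightarrow> real \<Rightarrow> identity_alg \<Rightarrow> fi_alg" where
  "fi_procedure \<epsilon> \<delta> T Q0 Q1 x0 x1 =
     (if \<not> aDP \<epsilon> \<delta> Q0 Q1 then return_pmf Reject
      else do {
        v0 \<leftarrow> T Q0 x0;
        v1 \<leftarrow> T Q1 x1;
        return_pmf (if v0 = Reject \<or> v1 = Reject then Reject else Accept)
      })"

end

(* If (Q0,Q1) is (eps,delta)-aDP and (P0,P1) is alpha-far from it, then
   max (TV(Q0,P0), TV(Q1,P1)) > alpha / (1 + e^eps) =: a. So it suffices to have an identity tester
   with proximity a, O(sqrt n / a^2) samples and error probability 1/6; for alpha > 1 nothing is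
   far and no samples are needed.

   The identity tester thresholds an unbiased estimate of the smoothed chi-square divergence
   X = sum_i (q_i - p_i)^2 / w_i with w_i = (p_i + 1/n) / 2. Cauchy-Schwarz gives X >= TV^2. Since
   w_i >= 1/(2n) and p_i <= 2 w_i, the variance of the estimate from two independent blocks of m
   samples is O(n + nX + m (1 + sqrt (nX)) X) / m^2, so for m of order sqrt n / a^2 Chebyshev's
   inequality separates X = 0 from X >= a^2. *)

theory Submission
  imports Defs
begin

section \<open>Moments of sums over independent samples from finitely supported
  distributions\<close>

lemma expectation_pair_pmf_finite:
  fixes f :: "'a \<times> 'b \<Rightarrow> real"
  assumes "finite (set_pmf A)" "finite (set_pmf B)"
  shows "measure_pmf.expectation (pair_pmf A B) f =
         measure_pmf.expectation A (\<lambda>x. measure_pmf.expectation B (\<lambda>y. f (x, y)))"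
proof -
  have "measure_pmf.expectation (pair_pmf A B) f =
        (\<Sum>z\<in>set_pmf A \<times> set_pmf B. f z * pmf (pair_pmf A B) z)"
    using assms by (intro integral_measure_pmf_real) auto
  also have "\<dots> = (\<Sum>x\<in>set_pmf A. \<Sum>y\<in>set_pmf B. f (x, y) * (pmf A x * pmf B y))"
    by (auto simp: sum.cartesian_product pmf_pair intro!: sum.cong)
  also have "\<dots> = measure_pmf.expectation A (\<lambda>x. measure_pmf.expectation B (\<lambda>y. f (x, y)))"
    using assms by (simp add: integral_measure_pmf_real[of "set_pmf A" A]
        integral_measure_pmf_real[of "set_pmf B" B] sum_distrib_left sum_distrib_right mult_ac)
  finally show ?thesis .
qed

lemma expectation_swap_finite:
  fixes f :: "'a \<Rightarrow> 'b \<Rightarrow> real"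
  assumes "finite (set_pmf A)" "finite (set_pmf B)"
  shows "measure_pmf.expectation A (\<lambda>x. measure_pmf.expectation B (f x)) =
         measure_pmf.expectation B (\<lambda>y. measure_pmf.expectation A (\<lambda>x. f x y))"
  using assms by (simp add: integral_measure_pmf_real[of "set_pmf A" A]
      integral_measure_pmf_real[of "set_pmf B" B] sum_distrib_left sum_distrib_right mult_ac)
    (rule sum.swap)

lemma finite_set_replicate_pmf:
  assumes "finite (set_pmf p)"
  shows "finite (set_pmf (replicate_pmf m p))"
  using finite_lists_length_eq[OF assms, of m]
  by (auto simp: set_replicate_pmf lists_eq_set conj_commute elim!: rev_finite_subset)

lemma replicate_pmf_Suc_pair:
  "replicate_pmf (Suc m) p = map_pmf (\<lambda>(x, xs). x # xs) (pair_pmf p (replicate_pmf m p))"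
  by (simp add: map_pmf_def pair_pmf_def bind_assoc_pmf bind_return_pmf)

lemma expectation_sum_list_replicate_pmf:
  fixes f :: "'a \<Rightarrow> real"
  assumes fin: "finite (set_pmf p)"
  shows "measure_pmf.expectation (replicate_pmf m p) (\<lambda>xs. \<Sum>x\<leftarrow>xs. f x) =
         real m * measure_pmf.expectation p f"
proof (induction m)
  case (Suc m)
  note int = integrable_measure_pmf_finite[OF fin]
    integrable_measure_pmf_finite[OF finite_set_replicate_pmf[OF fin]]
  show ?case
    unfolding replicate_pmf_Suc_pair
    by (simp add: expectation_pair_pmf_finite fin finite_set_replicate_pmf int Suc algebra_simps
        del: replicate_pmf.simps)
qed simp

text \<open>In the expanded square, the m diagonal terms give the second moment and each of the m (m
  - 1) off-diagonal terms factors by independence.\<close>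

lemma expectation_sum_list_square_replicate_pmf:
  fixes f :: "'a \<Rightarrow> real"
  assumes fin: "finite (set_pmf p)"
  shows "measure_pmf.expectation (replicate_pmf m p) (\<lambda>xs. (\<Sum>x\<leftarrow>xs. f x)\<^sup>2) =
         real m * measure_pmf.expectation p (\<lambda>x. (f x)\<^sup>2) +
         real m * (real m - 1) * (measure_pmf.expectation p f)\<^sup>2"
proof (induction m)
  case (Suc m)
  note int = integrable_measure_pmf_finite[OF fin]
    integrable_measure_pmf_finite[OF finite_set_replicate_pmf[OF fin]]
  have "measure_pmf.expectation (replicate_pmf (Suc m) p) (\<lambda>xs. (\<Sum>x\<leftarrow>xs. f x)\<^sup>2) =
        measure_pmf.expectation p (\<lambda>x. (f x)\<^sup>2) +
        2 * measure_pmf.expectation p f * (real m * measure_pmf.expectation p f) +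
        measure_pmf.expectation (replicate_pmf m p) (\<lambda>xs. (\<Sum>x\<leftarrow>xs. f x)\<^sup>2)"
    unfolding replicate_pmf_Suc_pair
    by (simp add: expectation_pair_pmf_finite fin finite_set_replicate_pmf int power2_sum
        expectation_sum_list_replicate_pmf del: replicate_pmf.simps)
  then show ?case
    unfolding Suc by (simp add: algebra_simps power2_eq_square)
qed simp

text \<open>Only pairs from different blocks occur, so no sample is paired with itself and the
  estimate of a double expectation is unbiased. The sum over \<open>ys\<close> is outermost because
  the expectation over a pair of blocks integrates \<open>ys\<close> first; the one-block moment
  formulas then apply directly.\<close>

definition cross_sum :: "('a \<Rightarrow> 'b \<Rightarrow> real) \<Rightarrow> 'a list \<Rightarrow> 'b list \<Rightarrow> real" where
  "cross_sum h xs ys = (\<Sum>y\<leftarrow>ys. \<Sum>x\<leftarrow>xs. h x y)"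

lemma expectation_cross_sum:
  fixes h :: "'a \<Rightarrow> 'b \<Rightarrow> real"
  assumes fin: "finite (set_pmf p)" "finite (set_pmf q)"
  shows "measure_pmf.expectation (pair_pmf (replicate_pmf m p) (replicate_pmf m q))
           (\<lambda>(xs, ys). cross_sum h xs ys) =
         (real m)\<^sup>2 * measure_pmf.expectation p (\<lambda>x. measure_pmf.expectation q (h x))"
proof -
  have "measure_pmf.expectation (pair_pmf (replicate_pmf m p) (replicate_pmf m q))
           (\<lambda>(xs, ys). cross_sum h xs ys) =
        real m * measure_pmf.expectation (replicate_pmf m p)
          (\<lambda>xs. measure_pmf.expectation q (\<lambda>y. \<Sum>x\<leftarrow>xs. h x y))"
    by (simp add: expectation_pair_pmf_finite fin finite_set_replicate_pmf cross_sum_def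
        expectation_sum_list_replicate_pmf)
  also have "\<dots> = real m * measure_pmf.expectation q
          (\<lambda>y. real m * measure_pmf.expectation p (\<lambda>x. h x y))"
    by (subst expectation_swap_finite)
       (simp_all add: fin finite_set_replicate_pmf expectation_sum_list_replicate_pmf)
  also have "\<dots> = (real m)\<^sup>2 * measure_pmf.expectation p (\<lambda>x. measure_pmf.expectation q (h x))"
    by (subst expectation_swap_finite[OF fin]) (simp add: power2_eq_square)
  finally show ?thesis .
qed

text \<open>The square ranges over two index pairs. They may coincide (m^2 cases), share only the
  first or only the second index (m^2 (m - 1) cases each), or share neither (m^2 (m - 1)^2 cases).
  Sharing one index leaves the second moment of a conditional mean.\<close>

lemma expectation_cross_sum_square:
  fixes h :: "'a \<Rightarrow> 'b \<Rightarrow> real"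
  assumes fin: "finite (set_pmf p)" "finite (set_pmf q)"
  shows "measure_pmf.expectation (pair_pmf (replicate_pmf m p) (replicate_pmf m q))
           (\<lambda>(xs, ys). (cross_sum h xs ys)\<^sup>2) =
         (real m)\<^sup>2 *
         (measure_pmf.expectation p (\<lambda>x. measure_pmf.expectation q (\<lambda>y. (h x y)\<^sup>2)) +
          (real m - 1) *
            (measure_pmf.expectation p (\<lambda>x. (measure_pmf.expectation q (h x))\<^sup>2) +
             measure_pmf.expectation q (\<lambda>y. (measure_pmf.expectation p (\<lambda>x. h x y))\<^sup>2)) +
          (real m - 1)\<^sup>2 *
            (measure_pmf.expectation p (\<lambda>x. measure_pmf.expectation q (h x)))\<^sup>2)"
proof -
  note int = integrable_measure_pmf_finite[OF fin(1)] integrable_measure_pmf_finite[OF fin(2)]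
    integrable_measure_pmf_finite[OF finite_set_replicate_pmf[OF fin(1)]]
    integrable_measure_pmf_finite[OF finite_set_replicate_pmf[OF fin(2)]]
  \<comment> \<open>Averaging over y turns the inner sum into a sum of conditional means over
    \<open>xs\<close>, to which the one-block second moment formula applies again.\<close>
  have sl: "measure_pmf.expectation q (\<lambda>y. \<Sum>x\<leftarrow>xs. h x y) =
      (\<Sum>x\<leftarrow>xs. measure_pmf.expectation q (h x))" for xs
    by (induction xs) (simp_all add: int)
  have "measure_pmf.expectation (pair_pmf (replicate_pmf m p) (replicate_pmf m q))
           (\<lambda>(xs, ys). (cross_sum h xs ys)\<^sup>2) =
        real m * measure_pmf.expectation (replicate_pmf m p)
          (\<lambda>xs. measure_pmf.expectation q (\<lambda>y. (\<Sum>x\<leftarrow>xs. h x y)\<^sup>2)) +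
        real m * (real m - 1) * measure_pmf.expectation (replicate_pmf m p)
          (\<lambda>xs. (\<Sum>x\<leftarrow>xs. measure_pmf.expectation q (h x))\<^sup>2)"
    by (simp add: expectation_pair_pmf_finite fin finite_set_replicate_pmf cross_sum_def
        expectation_sum_list_square_replicate_pmf int sl)
  also have "measure_pmf.expectation (replicate_pmf m p)
          (\<lambda>xs. measure_pmf.expectation q (\<lambda>y. (\<Sum>x\<leftarrow>xs. h x y)\<^sup>2)) =
        real m * measure_pmf.expectation p (\<lambda>x. measure_pmf.expectation q (\<lambda>y. (h x y)\<^sup>2)) +
        real m * (real m - 1) *
          measure_pmf.expectation q (\<lambda>y. (measure_pmf.expectation p (\<lambda>x. h x y))\<^sup>2)"
    by (subst expectation_swap_finite)
       (simp_all add: fin finite_set_replicate_pmf expectation_sum_list_square_replicate_pmf int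
         expectation_swap_finite[OF fin, of "\<lambda>x y. (h x y)\<^sup>2"])
  finally show ?thesis
    unfolding expectation_sum_list_square_replicate_pmf[OF fin(1)] by algebra
qed

text \<open>The variance is written as second moment minus squared mean, the form in which the
  moments of \<open>cross_sum\<close> are computed.\<close>

lemma Chebyshev_finite_pmf:
  fixes Z :: "'a \<Rightarrow> real"
  assumes fin: "finite (set_pmf p)" and "t > 0"
  shows "measure_pmf.prob p {z. \<bar>Z z - measure_pmf.expectation p Z\<bar> \<ge> t} \<le>
         (measure_pmf.expectation p (\<lambda>z. (Z z)\<^sup>2) - (measure_pmf.expectation p Z)\<^sup>2) / t\<^sup>2"
proof -
  note int = integrable_measure_pmf_finite[OF fin]
  let ?S = "{z. \<bar>Z z - measure_pmf.expectation p Z\<bar> \<ge> t}"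
  have "measure_pmf.prob p ?S = measure_pmf.expectation p (indicator ?S)"
    by simp
  also have "\<dots> \<le> measure_pmf.expectation p (\<lambda>z. (Z z - measure_pmf.expectation p Z)\<^sup>2 / t\<^sup>2)"
  proof (intro integral_mono int)
    fix z
    show "indicator ?S z \<le> (Z z - measure_pmf.expectation p Z)\<^sup>2 / t\<^sup>2"
      using \<open>t > 0\<close> power_mono[of t "\<bar>Z z - measure_pmf.expectation p Z\<bar>" 2]
      by (auto simp: indicator_def divide_simps)
  qed
  also have "\<dots> = (measure_pmf.expectation p (\<lambda>z. (Z z)\<^sup>2) - (measure_pmf.expectation p Z)\<^sup>2) / t\<^sup>2"
    by (simp add: power2_diff int) (simp add: power2_eq_square)
  finally show ?thesis .
qed


section \<open>The smoothed chi-square divergence, its kernel, and total variation\<close>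

lemma expectation_dist_on:
  fixes f :: "nat \<Rightarrow> real"
  assumes "dist_on n Q"
  shows "measure_pmf.expectation Q f = (\<Sum>i=1..n. pmf Q i * f i)"
  using assms by (subst integral_measure_pmf_real[of "{1..n}"]) (auto simp: dist_on_def mult.commute)

lemma finite_dist_on: "dist_on n Q \<Longrightarrow> finite (set_pmf Q)"
  unfolding dist_on_def by (rule finite_subset) auto

lemma sum_pmf_dist_on: "dist_on n Q \<Longrightarrow> (\<Sum>i=1..n. pmf Q i) = 1"
  unfolding dist_on_def by (rule sum_pmf_eq_1) auto

definition smoothed :: "nat \<Rightarrow> nat pmf \<Rightarrow> nat \<Rightarrow> real" where
  "smoothed n P i = (pmf P i + 1 / real n) / 2"

definition chi_square :: "nat \<Rightarrow> nat pmf \<Rightarrow> nat pmf \<Rightarrow> real" where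
  "chi_square n P Q = (\<Sum>i=1..n. (pmf Q i - pmf P i)\<^sup>2 / smoothed n P i)"

text \<open>With e_x the unit vector at x, this is the inner product of e_x - p and e_y - p with
  weights 1 / w_i. It depends on P only, hence is computable by the tester, and its mean over
  independent x, y from Q is \<open>chi_square n P Q\<close>.\<close>

definition chi_kernel :: "nat \<Rightarrow> nat pmf \<Rightarrow> nat \<Rightarrow> nat \<Rightarrow> real" where
  "chi_kernel n P x y =
     (\<Sum>i=1..n. (indicator {i} x - pmf P i) * (indicator {i} y - pmf P i) / smoothed n P i)"

lemma chi_kernel_commute: "chi_kernel n P x y = chi_kernel n P y x"
  by (simp add: chi_kernel_def mult.commute)

lemma
  assumes "n \<ge> 1"
  shows smoothed_pos: "smoothed n P i > 0"
    and pmf_div_smoothed_le: "pmf P i / smoothed n P i \<le> 2"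
    and inverse_smoothed_le: "1 / smoothed n P i \<le> 2 * real n"
proof -
  show pos: "smoothed n P i > 0"
    using assms by (auto simp: smoothed_def intro!: add_nonneg_pos)
  have ge: "1 / (2 * real n) \<le> smoothed n P i"
    by (simp add: smoothed_def field_simps)
  have "pmf P i \<le> 2 * smoothed n P i"
    by (simp add: smoothed_def)
  then show "pmf P i / smoothed n P i \<le> 2"
    using pos by (simp add: divide_simps)
  show "1 / smoothed n P i \<le> 2 * real n"
    using ge pos assms by (simp add: field_simps)
qed

lemma sum_smoothed:
  assumes "n \<ge> 1" "dist_on n P"
  shows "(\<Sum>i=1..n. smoothed n P i) = 1"
  using assms sum_pmf_dist_on[of n P]
  by (simp add: smoothed_def sum.distrib flip: sum_divide_distrib)

lemma chi_square_nonneg: "n \<ge> 1 \<Longrightarrow> chi_square n P Q \<ge> 0"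
  unfolding chi_square_def by (intro sum_nonneg divide_nonneg_pos smoothed_pos) auto

lemma chi_square_refl [simp]: "chi_square n P P = 0"
  by (simp add: chi_square_def)

lemma prob_diff_le_tv_dist: "\<bar>measure_pmf.prob P E - measure_pmf.prob Q E\<bar> \<le> tv_dist P Q"
  unfolding tv_dist_def
proof (rule cSUP_upper)
  have "\<bar>measure_pmf.prob P E - measure_pmf.prob Q E\<bar> \<le> 1" for E
    using measure_pmf.prob_le_1[of P E] measure_pmf.prob_le_1[of Q E]
      measure_nonneg[of P E] measure_nonneg[of Q E] by linarith
  then show "bdd_above (range (\<lambda>E. \<bar>measure_pmf.prob P E - measure_pmf.prob Q E\<bar>))"
    by (intro bdd_aboveI[of _ 1]) auto
qed simp

lemma tv_dist_le_1: "tv_dist P Q \<le> 1"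
  unfolding tv_dist_def
proof (rule cSUP_least)
  fix E
  show "\<bar>measure_pmf.prob P E - measure_pmf.prob Q E\<bar> \<le> 1"
    using measure_pmf.prob_le_1[of P E] measure_pmf.prob_le_1[of Q E]
      measure_nonneg[of P E] measure_nonneg[of Q E] by linarith
qed simp

lemma tv_dist_nonneg: "0 \<le> tv_dist P Q"
  using prob_diff_le_tv_dist[of P "{}" Q] by simp

text \<open>The right-hand side is in fact twice the distance; the lost factor affects only
  constants.\<close>

lemma tv_dist_le_sum:
  assumes "dist_on n P" "dist_on n Q"
  shows "tv_dist P Q \<le> (\<Sum>i=1..n. \<bar>pmf Q i - pmf P i\<bar>)"
  unfolding tv_dist_def
proof (rule cSUP_least)
  fix E
  have prob: "measure_pmf.prob R E = (\<Sum>i\<in>E \<inter> {1..n}. pmf R i)" if "dist_on n R" for R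
  proof -
    have "measure_pmf.prob R E = measure_pmf.prob R (E \<inter> {1..n})"
      using that by (intro measure_eq_AE) (auto simp: AE_measure_pmf_iff dist_on_def)
    then show ?thesis
      by (simp add: measure_measure_pmf_finite)
  qed
  have "\<bar>measure_pmf.prob P E - measure_pmf.prob Q E\<bar> \<le> (\<Sum>i\<in>E \<inter> {1..n}. \<bar>pmf Q i - pmf P i\<bar>)"
    unfolding prob[OF assms(1)] prob[OF assms(2)] sum_subtractf[symmetric]
    by (rule order_trans[OF sum_abs]) (simp add: abs_minus_commute)
  also have "\<dots> \<le> (\<Sum>i=1..n. \<bar>pmf Q i - pmf P i\<bar>)"
    by (intro sum_mono2) auto
  finally show "\<bar>measure_pmf.prob P E - measure_pmf.prob Q E\<bar> \<le> \<dots>" .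
qed simp

lemma tv_dist_square_le_chi_square:
  assumes "n \<ge> 1" "dist_on n P" "dist_on n Q"
  shows "(tv_dist P Q)\<^sup>2 \<le> chi_square n P Q"
proof -
  let ?w = "smoothed n P"
  note pos = smoothed_pos[OF assms(1)]
  have "(tv_dist P Q)\<^sup>2 \<le> (\<Sum>i=1..n. \<bar>pmf Q i - pmf P i\<bar>)\<^sup>2"
    using tv_dist_le_sum[OF assms(2,3)] tv_dist_nonneg by (rule power_mono)
  \<comment> \<open>This factorization makes the second Cauchy-Schwarz factor the sum of the w_i,
    which is 1.\<close>
  also have "(\<Sum>i=1..n. \<bar>pmf Q i - pmf P i\<bar>) =
      (\<Sum>i=1..n. (\<bar>pmf Q i - pmf P i\<bar> / sqrt (?w i)) * sqrt (?w i))"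
    using pos[of P] by (intro sum.cong) (auto simp: less_imp_neq[symmetric])
  also have "\<dots>\<^sup>2 \<le> (\<Sum>i=1..n. (\<bar>pmf Q i - pmf P i\<bar> / sqrt (?w i))\<^sup>2) * (\<Sum>i=1..n. (sqrt (?w i))\<^sup>2)"
    by (rule Cauchy_Schwarz_ineq_sum)
  also have "\<dots> = chi_square n P Q"
    using pos[of P] sum_smoothed[OF assms(1,2)]
    by (simp add: chi_square_def power_divide less_imp_le)
  finally show ?thesis .
qed

lemma sum_indicator_singleton:
  fixes g :: "nat \<Rightarrow> real"
  assumes "z \<in> {1..n}"
  shows "(\<Sum>i=1..n. indicator {i} z * g i) = g z"
proof -
  have "(\<Sum>i=1..n. indicator {i} z * g i) = (\<Sum>i=1..n. if i = z then g i else 0)"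
    by (intro sum.cong) auto
  then show ?thesis using assms by simp
qed

section \<open>Mean and variance of the kernel statistic\<close>

lemma expectation_chi_kernel:
  assumes "dist_on n Q"
  shows "measure_pmf.expectation Q (chi_kernel n P x) =
    (\<Sum>i=1..n. (indicator {i} x - pmf P i) * (pmf Q i - pmf P i) / smoothed n P i)"
proof -
  note int = integrable_measure_pmf_finite[OF finite_dist_on[OF assms]]
  show ?thesis
    unfolding chi_kernel_def by (simp add: int measure_pmf_single)
qed

lemma expectation_expectation_chi_kernel:
  assumes "dist_on n Q"
  shows "measure_pmf.expectation Q (\<lambda>x. measure_pmf.expectation Q (chi_kernel n P x)) =
    chi_square n P Q"
proof -
  note int = integrable_measure_pmf_finite[OF finite_dist_on[OF assms]]
  show ?thesis
    unfolding expectation_chi_kernel[OF assms] chi_square_def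
    by (simp add: int measure_pmf_single power2_eq_square)
qed

text \<open>The second moment under Q of s(x) = (q_x - p_x) / w_x, which is the conditional mean of
  the kernel given x, up to an additive constant.\<close>

definition ratio_second_moment :: "nat \<Rightarrow> nat pmf \<Rightarrow> nat pmf \<Rightarrow> real" where
  "ratio_second_moment n P Q = (\<Sum>i=1..n. pmf Q i * ((pmf Q i - pmf P i) / smoothed n P i)\<^sup>2)"

text \<open>On the support of Q the conditional mean is s(x) - c, and its mean is X, the chi-square
  value. Its second moment is therefore Var(s) + X^2, and Var(s) is at most the second moment of
  s.\<close>

lemma expectation_square_marginal_chi_kernel_le:
  assumes "dist_on n Q"
  shows "measure_pmf.expectation Q (\<lambda>x. (measure_pmf.expectation Q (chi_kernel n P x))\<^sup>2) \<le>
    ratio_second_moment n P Q + (chi_square n P Q)\<^sup>2"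
proof -
  note int = integrable_measure_pmf_finite[OF finite_dist_on[OF assms]]
  define c where "c = (\<Sum>i=1..n. pmf P i * (pmf Q i - pmf P i) / smoothed n P i)"
  define s where "s = (\<lambda>x. (pmf Q x - pmf P x) / smoothed n P x)"
  have eq: "measure_pmf.expectation Q (chi_kernel n P x) = s x - c" if "x \<in> {1..n}" for x
  proof -
    have "measure_pmf.expectation Q (chi_kernel n P x) = (\<Sum>i=1..n. indicator {i} x * s i) - c"
      unfolding expectation_chi_kernel[OF assms] c_def s_def sum_subtractf[symmetric]
      by (intro sum.cong) (auto simp: algebra_simps diff_divide_distrib add_divide_distrib)
    then show ?thesis
      using sum_indicator_singleton[OF that] by simp
  qed
  \<comment> \<open>The formula for the conditional mean holds only on {1..n}, so it is transferred
    almost everywhere; F is used as the identity for the mean and as the square for the second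
    moment.\<close>
  have eq': "measure_pmf.expectation Q (\<lambda>x. F (measure_pmf.expectation Q (chi_kernel n P x))) =
    measure_pmf.expectation Q (\<lambda>x. F (s x - c))" for F :: "real \<Rightarrow> real"
    using assms by (intro integral_cong_AE)
      (auto simp: AE_measure_pmf_iff dist_on_def eq subset_iff)
  have mean: "measure_pmf.expectation Q s - c = chi_square n P Q"
    using eq'[of "\<lambda>z. z"] unfolding expectation_expectation_chi_kernel[OF assms]
    by (simp add: int)
  have "measure_pmf.expectation Q (\<lambda>x. (measure_pmf.expectation Q (chi_kernel n P x))\<^sup>2) =
    measure_pmf.expectation Q (\<lambda>x. (s x)\<^sup>2) - 2 * measure_pmf.expectation Q s * c + c\<^sup>2"
    unfolding eq'[of "\<lambda>z. z\<^sup>2"] by (simp add: int power2_diff)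
  also have "\<dots> = ratio_second_moment n P Q + (chi_square n P Q)\<^sup>2 - (measure_pmf.expectation Q s)\<^sup>2"
    unfolding mean[symmetric] ratio_second_moment_def s_def expectation_dist_on[OF assms]
    by (simp add: power2_diff algebra_simps)
  also have "\<dots> \<le> ratio_second_moment n P Q + (chi_square n P Q)\<^sup>2"
    by simp
  finally show ?thesis .
qed

text \<open>Each summand is (q_i / w_i) (d_i^2 / w_i) with d_i = q_i - p_i, so a uniform bound on
  q_i / w_i = p_i / w_i + d_i / w_i suffices. The first part is at most 2; the square of the second
  is (1 / w_i) (d_i^2 / w_i), at most 2n times the whole divergence.\<close>

lemma ratio_second_moment_le:
  assumes "n \<ge> 1"
  shows "ratio_second_moment n P Q \<le> (2 + sqrt (2 * real n * chi_square n P Q)) * chi_square n P Q"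
  unfolding ratio_second_moment_def
proof -
  let ?X = "chi_square n P Q" and ?w = "smoothed n P"
  let ?d = "\<lambda>i. pmf Q i - pmf P i"
  note pos = smoothed_pos[OF assms, of P]
  have *: "pmf Q i * (?d i / ?w i)\<^sup>2 \<le> (2 + sqrt (2 * real n * ?X)) * ((?d i)\<^sup>2 / ?w i)"
    if i: "i \<in> {1..n}" for i
  proof -
    have "(?d i / ?w i)\<^sup>2 = (1 / ?w i) * ((?d i)\<^sup>2 / ?w i)"
      by (simp add: power2_eq_square)
    also have "\<dots> \<le> (2 * real n) * ?X"
    proof (rule mult_mono)
      show "(?d i)\<^sup>2 / ?w i \<le> ?X"
        unfolding chi_square_def using i less_imp_le[OF pos]
        by (intro member_le_sum) (auto intro!: divide_nonneg_nonneg)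
    qed (use inverse_smoothed_le[OF assms] less_imp_le[OF pos] in auto)
    finally have "\<bar>?d i / ?w i\<bar> \<le> sqrt (2 * real n * ?X)"
      by (intro real_le_rsqrt) (simp only: power2_abs)
    moreover have "pmf Q i / ?w i = pmf P i / ?w i + ?d i / ?w i"
      by (simp add: diff_divide_distrib)
    ultimately have "pmf Q i / ?w i \<le> 2 + sqrt (2 * real n * ?X)"
      using pmf_div_smoothed_le[OF assms, of P i] by linarith
    moreover have "pmf Q i * (?d i / ?w i)\<^sup>2 = pmf Q i / ?w i * ((?d i)\<^sup>2 / ?w i)"
      by (simp add: power2_eq_square)
    ultimately show ?thesis
      using less_imp_le[OF pos] by (metis divide_nonneg_nonneg mult_right_mono zero_le_power2)
  qed
  have "(\<Sum>i=1..n. pmf Q i * (?d i / ?w i)\<^sup>2) \<le>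
        (\<Sum>i=1..n. (2 + sqrt (2 * real n * ?X)) * ((?d i)\<^sup>2 / ?w i))"
    by (intro sum_mono *)
  then show "(\<Sum>i=1..n. pmf Q i * (?d i / ?w i)\<^sup>2) \<le> (2 + sqrt (2 * real n * ?X)) * ?X"
    by (simp add: chi_square_def sum_distrib_left)
qed

text \<open>Multiplying out the kernel isolates a collision term, 1 / w_x when x = y, from a
  remainder built of three quantities in [0, 2]. The remainder is at most 6 in absolute value, and
  72 = 2 * 6^2.\<close>

lemma chi_kernel_square_le:
  assumes n: "n \<ge> 1" and P: "dist_on n P" and xy: "x \<in> {1..n}" "y \<in> {1..n}"
  shows "(chi_kernel n P x y)\<^sup>2 \<le> 2 * ((if x = y then 1 else 0) / (smoothed n P x)\<^sup>2) + 72"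
proof -
  let ?w = "smoothed n P"
  note pos = smoothed_pos[OF n, of P]
  define c where "c = (\<Sum>i=1..n. pmf P i * (pmf P i / ?w i))"
  define e where "e = (if x = y then 1 else 0) / ?w x"
  have "chi_kernel n P x y = (\<Sum>i=1..n. indicator {i} x * (indicator {i} y / ?w i)) -
      (\<Sum>i=1..n. indicator {i} x * (pmf P i / ?w i)) -
      (\<Sum>i=1..n. indicator {i} y * (pmf P i / ?w i)) + c"
    unfolding chi_kernel_def c_def sum_subtractf[symmetric] sum.distrib[symmetric]
    by (intro sum.cong) (auto simp: algebra_simps diff_divide_distrib add_divide_distrib)
  also have "\<dots> = e - (pmf P x / ?w x + pmf P y / ?w y - c)"
    unfolding sum_indicator_singleton[OF xy(1)] sum_indicator_singleton[OF xy(2)] by (auto simp: e_def indicator_def)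
  finally have eq: "chi_kernel n P x y = e - (pmf P x / ?w x + pmf P y / ?w y - c)" .
  have "c \<le> (\<Sum>i=1..n. pmf P i * 2)"
    unfolding c_def by (intro sum_mono mult_left_mono pmf_div_smoothed_le n) simp
  then have "c \<le> 2"
    using sum_pmf_dist_on[OF P] by (simp flip: sum_distrib_right)
  moreover have "c \<ge> 0"
    unfolding c_def using less_imp_le[OF pos] by (intro sum_nonneg mult_nonneg_nonneg divide_nonneg_nonneg) auto
  moreover have "pmf P z / ?w z \<ge> 0" "pmf P z / ?w z \<le> 2" for z
    using pmf_div_smoothed_le[OF n] less_imp_le[OF pos] by auto
  ultimately have b: "\<bar>pmf P x / ?w x + pmf P y / ?w y - c\<bar> \<le> 6"
    by (smt (verit))
  have sq: "(u - v)\<^sup>2 \<le> 2 * u\<^sup>2 + 2 * v\<^sup>2" for u v :: real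
    using zero_le_power2[of "u + v"] by (simp add: power2_sum power2_diff)
  have "(pmf P x / ?w x + pmf P y / ?w y - c)\<^sup>2 \<le> 6\<^sup>2"
    using b by (subst abs_le_square_iff[symmetric]) simp
  then have "(chi_kernel n P x y)\<^sup>2 \<le> 2 * e\<^sup>2 + 72"
    unfolding eq using sq[of e "pmf P x / ?w x + pmf P y / ?w y - c"] by simp
  also have "e\<^sup>2 = (if x = y then 1 else 0) / (?w x)\<^sup>2"
    by (simp add: e_def power_divide)
  finally show ?thesis .
qed

text \<open>Collisions contribute 2 times the sum of (q_i / w_i)^2. Splitting q_i / w_i as p_i / w_i
  + d_i / w_i bounds that sum by 8n + 4nX, and 88n collects 16n and the constant 72, which is at
  most 72n.\<close>

lemma expectation_square_chi_kernel_le: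
  assumes n: "n \<ge> 1" and P: "dist_on n P" and Q: "dist_on n Q"
  shows "measure_pmf.expectation Q (\<lambda>x. measure_pmf.expectation Q (\<lambda>y. (chi_kernel n P x y)\<^sup>2)) \<le>
         88 * real n + 8 * real n * chi_square n P Q"
proof -
  let ?w = "smoothed n P" and ?d = "\<lambda>i. pmf Q i - pmf P i"
  note pos = smoothed_pos[OF n, of P]
  note int = integrable_measure_pmf_finite[OF finite_dist_on[OF Q]]
  have "measure_pmf.expectation Q (\<lambda>x. measure_pmf.expectation Q (\<lambda>y. (chi_kernel n P x y)\<^sup>2)) \<le>
        measure_pmf.expectation Q (\<lambda>x. measure_pmf.expectation Q
          (\<lambda>y. 2 * ((if x = y then 1 else 0) / (?w x)\<^sup>2) + 72))"
    unfolding expectation_dist_on[OF Q]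
    by (intro sum_mono mult_left_mono chi_kernel_square_le n P) auto
  also have "\<dots> = 2 * (\<Sum>i=1..n. (pmf Q i / ?w i)\<^sup>2) + 72"
  proof -
    have inner: "measure_pmf.expectation Q (\<lambda>y. 2 * ((if x = y then 1 else 0) / (?w x)\<^sup>2) + 72) =
        2 * (pmf Q x / (?w x)\<^sup>2) + 72" for x
    proof -
      have "(if x = y then 1 else 0 :: real) = indicator {x} y" for y
        by auto
      then show ?thesis
        by (simp add: int measure_pmf_single)
    qed
    show ?thesis
      unfolding inner by (simp add: int) (simp add: expectation_dist_on[OF Q] power_divide power2_eq_square
          sum_distrib_left mult_ac)
  qed
  also have "(\<Sum>i=1..n. (pmf Q i / ?w i)\<^sup>2) \<le> (\<Sum>i=1..n. 8 + 4 * real n * ((?d i)\<^sup>2 / ?w i))"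
  proof (rule sum_mono)
    fix i
    have sq: "(u + v)\<^sup>2 \<le> 2 * u\<^sup>2 + 2 * v\<^sup>2" for u v :: real
      using zero_le_power2[of "u - v"] by (simp add: power2_sum power2_diff)
    have "pmf Q i / ?w i = pmf P i / ?w i + ?d i / ?w i"
      by (simp add: diff_divide_distrib)
    then have "(pmf Q i / ?w i)\<^sup>2 \<le> 2 * (pmf P i / ?w i)\<^sup>2 + 2 * (?d i / ?w i)\<^sup>2"
      using sq by metis
    moreover have "(pmf P i / ?w i)\<^sup>2 \<le> 2\<^sup>2"
      using pmf_div_smoothed_le[OF n] less_imp_le[OF pos] by (intro power_mono) auto
    moreover have "(1 / ?w i) * ((?d i)\<^sup>2 / ?w i) \<le> 2 * real n * ((?d i)\<^sup>2 / ?w i)"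
      using less_imp_le[OF pos] by (intro mult_right_mono inverse_smoothed_le n) auto
    moreover have "(?d i / ?w i)\<^sup>2 = (1 / ?w i) * ((?d i)\<^sup>2 / ?w i)"
      by (simp add: power2_eq_square)
    ultimately show "(pmf Q i / ?w i)\<^sup>2 \<le> 8 + 4 * real n * ((?d i)\<^sup>2 / ?w i)"
      by simp
  qed
  also have "\<dots> = 8 * real n + 4 * real n * chi_square n P Q"
    by (simp add: chi_square_def sum.distrib sum_distrib_left)
  finally show ?thesis
    using n by simp
qed

text \<open>The squared mean m^4 X^2 absorbs every X^2 term of the second moment, so only the
  collision part A and the ratio part S remain.\<close>

lemma variance_cross_sum_chi_kernel_le:
  assumes n: "n \<ge> 1" and P: "dist_on n P" and Q: "dist_on n Q" and m: "m \<ge> 1"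
  shows "measure_pmf.expectation (pair_pmf (replicate_pmf m Q) (replicate_pmf m Q))
           (\<lambda>(xs, ys). (cross_sum (chi_kernel n P) xs ys)\<^sup>2)
         - ((real m)\<^sup>2 * chi_square n P Q)\<^sup>2 \<le>
         (real m)\<^sup>2 * (88 * real n + 8 * real n * chi_square n P Q +
           2 * real m * ((2 + sqrt (2 * real n * chi_square n P Q)) * chi_square n P Q))"
proof -
  let ?X = "chi_square n P Q"
  let ?S = "(2 + sqrt (2 * real n * ?X)) * ?X"
  define A where "A = measure_pmf.expectation Q
    (\<lambda>x. measure_pmf.expectation Q (\<lambda>y. (chi_kernel n P x y)\<^sup>2))"
  define B where "B = measure_pmf.expectation Q
    (\<lambda>x. (measure_pmf.expectation Q (chi_kernel n P x))\<^sup>2)"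
  \<comment> \<open>By symmetry of the kernel the two one-shared-index terms are equal.\<close>
  have comm: "measure_pmf.expectation Q (\<lambda>y. (measure_pmf.expectation Q (\<lambda>x. chi_kernel n P x y))\<^sup>2) = B"
    unfolding B_def by (subst chi_kernel_commute) simp
  have S: "?S \<ge> 0"
    using chi_square_nonneg[OF n] by simp
  have A: "A \<le> 88 * real n + 8 * real n * ?X"
    unfolding A_def by (rule expectation_square_chi_kernel_le[OF n P Q])
  have B: "B \<le> ?S + ?X\<^sup>2"
    unfolding B_def by (rule order_trans[OF expectation_square_marginal_chi_kernel_le[OF Q]]) (intro add_right_mono ratio_second_moment_le n)
  have "A + (real m - 1) * (B + B) + (real m - 1)\<^sup>2 * ?X\<^sup>2 - (real m)\<^sup>2 * ?X\<^sup>2 \<le>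
     A + (real m - 1) * (2 * (?S + ?X\<^sup>2)) + (real m - 1)\<^sup>2 * ?X\<^sup>2 - (real m)\<^sup>2 * ?X\<^sup>2"
    using B m mult_left_mono[of "B + B" "2 * (?S + ?X\<^sup>2)" "real m - 1"] by simp
  \<comment> \<open>The coefficient of X^2 is 2(m - 1) + (m - 1)^2 - m^2 = -1.\<close>
  also have "\<dots> = A + 2 * real m * ?S - 2 * ?S - ?X\<^sup>2"
    by algebra
  also have "\<dots> \<le> 88 * real n + 8 * real n * ?X + 2 * real m * ?S"
    using A S zero_le_power2[of ?X] by linarith
  finally have "(real m)\<^sup>2 * (A + (real m - 1) * (B + B) + (real m - 1)\<^sup>2 * ?X\<^sup>2 - (real m)\<^sup>2 * ?X\<^sup>2)
     \<le> (real m)\<^sup>2 * (88 * real n + 8 * real n * ?X + 2 * real m * ?S)"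
    by (rule mult_left_mono) simp
  moreover have "(real m)\<^sup>2 * (A + (real m - 1) * (B + B) + (real m - 1)\<^sup>2 * ?X\<^sup>2 - (real m)\<^sup>2 * ?X\<^sup>2)
     = (real m)\<^sup>2 * (A + (real m - 1) * (B + B) + (real m - 1)\<^sup>2 * ?X\<^sup>2) - ((real m)\<^sup>2 * ?X)\<^sup>2"
    by algebra
  ultimately show ?thesis
    unfolding expectation_cross_sum_square[OF finite_dist_on[OF Q] finite_dist_on[OF Q]]
      expectation_expectation_chi_kernel[OF Q] comm
    by (simp only: A_def B_def)
qed

section \<open>The thresholded chi-square statistic as an identity tester\<close>

definition chi_tester :: "nat \<Rightarrow> real \<Rightarrow> nat \<Rightarrow> identity_alg" where
  "chi_tester n a m P xs = return_pmf
     (if cross_sum (chi_kernel n P) (take m xs) (drop m xs) < (real m)\<^sup>2 * a\<^sup>2 / 2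
      then Accept else Reject)"

lemma pmf_verdict_Reject: "pmf V Reject = 1 - pmf V Accept"
proof -
  have univ: "(UNIV :: verdict set) = {Accept, Reject}"
    using verdict.nchotomy by blast
  have "(\<Sum>v\<in>UNIV. pmf V v) = 1"
    unfolding univ by (rule sum_pmf_eq_1[OF _ subset_UNIV[of "set_pmf V", unfolded univ]]) simp
  then show ?thesis
    unfolding univ by simp
qed

text \<open>Cutting 2m independent samples in the middle yields two independent blocks of m, the
  setting of the moment formulas.\<close>

lemma run_chi_tester_eq:
  "run_identity (2 * m) (chi_tester n a m) P Q =
   map_pmf (\<lambda>(xs, ys). if cross_sum (chi_kernel n P) xs ys < (real m)\<^sup>2 * a\<^sup>2 / 2
      then Accept else Reject) (pair_pmf (replicate_pmf m Q) (replicate_pmf m Q))"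
  unfolding run_identity_def mult_2 replicate_pmf_distrib chi_tester_def map_pmf_def pair_pmf_def
  by (auto simp: bind_assoc_pmf bind_return_pmf set_replicate_pmf intro!: bind_pmf_cong)

lemma pmf_run_chi_tester:
  "pmf (run_identity (2 * m) (chi_tester n a m) P Q) Accept =
     measure_pmf.prob (pair_pmf (replicate_pmf m Q) (replicate_pmf m Q))
       {z. (case z of (xs, ys) \<Rightarrow> cross_sum (chi_kernel n P) xs ys) < (real m)\<^sup>2 * a\<^sup>2 / 2}"
  unfolding run_chi_tester_eq pmf_map
  by (intro arg_cong[of _ _ "measure_pmf.prob _"]) (auto split: if_splits)

text \<open>Chebyshev at deviation m^2 t: the factor m^2 of the variance bound cancels against m^4
  t^2.\<close>

lemma cross_sum_chi_kernel_concentration: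
  assumes n: "n \<ge> 1" and P: "dist_on n P" and Q: "dist_on n Q" and m: "m \<ge> 1" and t: "t > 0"
  shows "measure_pmf.prob (pair_pmf (replicate_pmf m Q) (replicate_pmf m Q))
           {z. \<bar>(case z of (xs, ys) \<Rightarrow> cross_sum (chi_kernel n P) xs ys)
               - (real m)\<^sup>2 * chi_square n P Q\<bar> \<ge> (real m)\<^sup>2 * t} \<le>
         (88 * real n + 8 * real n * chi_square n P Q +
           2 * real m * ((2 + sqrt (2 * real n * chi_square n P Q)) * chi_square n P Q))
         / (real m * t)\<^sup>2"
proof -
  let ?D = "pair_pmf (replicate_pmf m Q) (replicate_pmf m Q)"
  let ?Z = "\<lambda>z. case z of (xs, ys) \<Rightarrow> cross_sum (chi_kernel n P) xs ys"
  let ?V = "88 * real n + 8 * real n * chi_square n P Q +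
           2 * real m * ((2 + sqrt (2 * real n * chi_square n P Q)) * chi_square n P Q)"
  have mean: "measure_pmf.expectation ?D ?Z = (real m)\<^sup>2 * chi_square n P Q"
    unfolding expectation_cross_sum[OF finite_dist_on[OF Q] finite_dist_on[OF Q]]
      expectation_expectation_chi_kernel[OF Q] ..
  have sq: "(?Z z)\<^sup>2 = (case z of (xs, ys) \<Rightarrow> (cross_sum (chi_kernel n P) xs ys)\<^sup>2)" for z
    by (simp split: prod.split)
  have mt: "(real m)\<^sup>2 * t > 0"
    using m t by simp
  have "measure_pmf.prob ?D {z. \<bar>?Z z - measure_pmf.expectation ?D ?Z\<bar> \<ge> (real m)\<^sup>2 * t} \<le>
     (measure_pmf.expectation ?D (\<lambda>z. (?Z z)\<^sup>2) - (measure_pmf.expectation ?D ?Z)\<^sup>2) / ((real m)\<^sup>2 * t)\<^sup>2"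
    using finite_set_replicate_pmf[OF finite_dist_on[OF Q], of m]
    by (intro Chebyshev_finite_pmf mt) simp
  also have "\<dots> \<le> ((real m)\<^sup>2 * ?V) / ((real m)\<^sup>2 * t)\<^sup>2"
    unfolding sq mean
    by (intro divide_right_mono variance_cross_sum_chi_kernel_le n P Q m) simp
  also have "\<dots> = ?V / (real m * t)\<^sup>2"
    using m t by (simp add: power2_eq_square)
  finally show ?thesis
    unfolding mean .
qed

text \<open>For Q = P the divergence vanishes, leaving only 88n in the variance bound. The threshold
  is half of m^2 a^2, and m a^2 / 2 \<ge> 500 sqrt n makes the failure probability at most 88 /
  250000.\<close>

lemma chi_tester_complete:
  assumes n: "n \<ge> 1" and P: "dist_on n P" and a: "a > 0" and m: "real m \<ge> 1000 * sqrt (real n) / a\<^sup>2"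
  shows "pmf (run_identity (2 * m) (chi_tester n a m) P P) Accept \<ge> 5/6"
proof -
  let ?D = "pair_pmf (replicate_pmf m P) (replicate_pmf m P)"
  let ?Z = "\<lambda>z. case z of (xs, ys) \<Rightarrow> cross_sum (chi_kernel n P) xs ys"
  have ma: "real m * (a\<^sup>2 / 2) \<ge> 500 * sqrt (real n)"
    using m a by (simp add: field_simps)
  have "(1000 * sqrt (real n)) / a\<^sup>2 > 0"
    using n a by simp
  then have m1: "m \<ge> 1"
    using m by (cases m) auto
  have "(500 * sqrt (real n))\<^sup>2 \<le> (real m * (a\<^sup>2 / 2))\<^sup>2"
    using ma by (rule power_mono) simp
  then have ma2: "250000 * real n \<le> (real m * (a\<^sup>2 / 2))\<^sup>2"
    by (simp add: power_mult_distrib)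
  have "measure_pmf.prob ?D {z. \<bar>?Z z\<bar> \<ge> (real m)\<^sup>2 * (a\<^sup>2 / 2)} \<le> 88 * real n / (real m * (a\<^sup>2 / 2))\<^sup>2"
    using cross_sum_chi_kernel_concentration[OF n P P m1, of "a\<^sup>2 / 2"] a by simp
  also have "\<dots> \<le> 88 * real n / (250000 * real n)"
    using ma2 n by (intro frac_le) auto
  also have "\<dots> \<le> 1/6"
    using n by simp
  finally have "measure_pmf.prob ?D {z. \<bar>?Z z\<bar> \<ge> (real m)\<^sup>2 * (a\<^sup>2 / 2)} \<le> 1/6" .
  moreover have "measure_pmf.prob ?D (- {z. \<bar>?Z z\<bar> \<ge> (real m)\<^sup>2 * (a\<^sup>2 / 2)}) \<le>
      measure_pmf.prob ?D {z. ?Z z < (real m)\<^sup>2 * a\<^sup>2 / 2}"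
    by (intro measure_pmf.finite_measure_mono) auto
  ultimately show ?thesis
    unfolding pmf_run_chi_tester using measure_pmf.prob_compl[of "{z. \<bar>?Z z\<bar> \<ge> (real m)\<^sup>2 * (a\<^sup>2 / 2)}" ?D]
    by (simp add: Compl_eq_Diff_UNIV)
qed

text \<open>The variance grows with X, so the deviation is taken as m^2 X / 2 rather than m^2 a^2 /
  2. In terms of y = m X, which is at least 1000 sqrt n, every variance term is a small multiple of
  y^2.\<close>

lemma chi_tester_sound:
  assumes n: "n \<ge> 1" and P: "dist_on n P" and Q: "dist_on n Q" and a: "a > 0" "a \<le> 1"
    and m: "real m \<ge> 1000 * sqrt (real n) / a\<^sup>2" and tv: "tv_dist P Q \<ge> a"
  shows "pmf (run_identity (2 * m) (chi_tester n a m) P Q) Reject \<ge> 5/6"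
proof -
  let ?D = "pair_pmf (replicate_pmf m Q) (replicate_pmf m Q)"
  let ?Z = "\<lambda>z. case z of (xs, ys) \<Rightarrow> cross_sum (chi_kernel n P) xs ys"
  define X where "X = chi_square n P Q"
  define s where "s = sqrt (real n)"
  have s: "s\<^sup>2 = real n" "s \<ge> 1"
    using n by (auto simp: s_def)
  have "a\<^sup>2 \<le> (tv_dist P Q)\<^sup>2"
    using tv a by (intro power_mono) auto
  then have X: "a\<^sup>2 \<le> X"
    using tv_dist_square_le_chi_square[OF n P Q] by (simp add: X_def)
  have a2: "0 < a\<^sup>2" "a\<^sup>2 \<le> 1"
    using a by (auto simp: power_le_one)
  have X0: "X > 0"
    using X a2 by linarith
  have m': "1000 * s \<le> real m * a\<^sup>2"
    using m a by (simp add: s_def field_simps)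
  also have "\<dots> \<le> real m * 1"
    using a2 by (intro mult_left_mono) auto
  finally have ms: "1000 * s \<le> real m" by simp
  then have m1: "m \<ge> 1"
    using s by (cases m) auto
  define y where "y = real m * X"
  have "real m * a\<^sup>2 \<le> y"
    unfolding y_def using X by (intro mult_left_mono) auto
  with m' have y: "1000 * s \<le> y" by linarith
  then have y0: "y \<ge> 1000" using s by linarith
  have n_le: "1000000 * real n \<le> y\<^sup>2"
    using power_mono[OF y, of 2] s by (simp add: power_mult_distrib)
  \<comment> \<open>Here a \<le> 1 enters, through 1000 sqrt n \<le> m: one factor sqrt n is charged
    to m and the other to y, and m y X = y^2.\<close>
  have nX: "1000000 * (real n * X) \<le> y\<^sup>2"
  proof -
    have "(1000 * s) * (1000 * s) \<le> real m * y"
      using ms y s by (intro mult_mono) auto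
    then have "(1000 * s) * (1000 * s) * X \<le> real m * y * X"
      using X0 by (intro mult_right_mono) auto
    then show ?thesis
      by (simp add: y_def power2_eq_square mult_ac flip: s(1))
  qed
  have sqrt_le: "sqrt (2 * real n * X) \<le> y / 500"
  proof (rule real_le_lsqrt)
    show "2 * real n * X \<le> (y / 500)\<^sup>2"
      using nX mult_nonneg_nonneg[OF of_nat_0_le_iff less_imp_le[OF X0], of n]
      by (simp add: power_divide)
  qed (use y0 in auto)
  \<comment> \<open>Since y \<ge> 1000, the summand 2 is at most y / 500, so the last term is at
    most 0.008 y^2; the other two are below 0.0001 y^2 together.\<close>
  have V: "88 * real n + 8 * real n * X + 2 * real m * ((2 + sqrt (2 * real n * X)) * X) \<le> y\<^sup>2 / 100"
  proof -
    have "2 * real m * ((2 + sqrt (2 * real n * X)) * X) = 2 * y * (2 + sqrt (2 * real n * X))"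
      by (simp add: y_def algebra_simps)
    also have "\<dots> \<le> 2 * y * (y / 500 + y / 500)"
      using sqrt_le y0 by (intro mult_left_mono add_mono) auto
    also have "\<dots> = 8 * y\<^sup>2 / 1000"
      by (simp add: power2_eq_square)
    finally show ?thesis
      using n_le nX by simp
  qed
  have "measure_pmf.prob ?D {z. \<bar>?Z z - (real m)\<^sup>2 * X\<bar> \<ge> (real m)\<^sup>2 * (X / 2)} \<le>
      (y\<^sup>2 / 100) / (real m * (X / 2))\<^sup>2"
    using cross_sum_chi_kernel_concentration[OF n P Q m1, of "X / 2"] X0
    by (intro order_trans[OF _ divide_right_mono[OF V]]) (auto simp: X_def)
  also have "\<dots> = 1 / 25"
    using m1 X0 by (simp add: y_def power2_eq_square)
  finally have far: "measure_pmf.prob ?D {z. \<bar>?Z z - (real m)\<^sup>2 * X\<bar> \<ge> (real m)\<^sup>2 * (X / 2)} \<le> 1/25" .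
  \<comment> \<open>Because a^2 \<le> X, an accepting statistic lies at least m^2 X / 2 below its
    mean m^2 X.\<close>
  have "pmf (run_identity (2 * m) (chi_tester n a m) P Q) Accept \<le>
      measure_pmf.prob ?D {z. \<bar>?Z z - (real m)\<^sup>2 * X\<bar> \<ge> (real m)\<^sup>2 * (X / 2)}"
    unfolding pmf_run_chi_tester
  proof (intro measure_pmf.finite_measure_mono subsetI CollectI)
    fix z
    assume "z \<in> {z. ?Z z < (real m)\<^sup>2 * a\<^sup>2 / 2}"
    moreover have "(real m)\<^sup>2 * a\<^sup>2 \<le> (real m)\<^sup>2 * X"
      using X by (intro mult_left_mono) auto
    moreover have "(real m)\<^sup>2 * (X / 2) = (real m)\<^sup>2 * X / 2"
      by simp
    ultimately have "(real m)\<^sup>2 * (X / 2) \<le> - (?Z z - (real m)\<^sup>2 * X)"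
      unfolding mem_Collect_eq by linarith
    then show "\<bar>?Z z - (real m)\<^sup>2 * X\<bar> \<ge> (real m)\<^sup>2 * (X / 2)"
      using abs_ge_minus_self by (rule order_trans)
  qed simp
  with far show ?thesis
    unfolding pmf_verdict_Reject by linarith
qed

section \<open>From identity testing to the full-information procedure\<close>

lemma run_fi_procedure_aDP:
  assumes "aDP \<epsilon> \<delta> Q0 Q1"
  shows "run_fi r (fi_procedure \<epsilon> \<delta> T) Q0 Q1 P0 P1 =
    map_pmf (\<lambda>(v0, v1). if v0 = Reject \<or> v1 = Reject then Reject else Accept)
      (pair_pmf (run_identity r T Q0 P0) (run_identity r T Q1 P1))"
proof -
  have "run_fi r (fi_procedure \<epsilon> \<delta> T) Q0 Q1 P0 P1 =
    do {x0 \<leftarrow> replicate_pmf r P0; x1 \<leftarrow> replicate_pmf r P1; v0 \<leftarrow> T Q0 x0; v1 \<leftarrow> T Q1 x1;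
        return_pmf (if v0 = Reject \<or> v1 = Reject then Reject else Accept)}"
    using assms by (simp add: run_fi_def fi_procedure_def)
  \<comment> \<open>Drawing \<open>x1\<close> commutes with the internal randomness of the first
    run, so the procedure consists of two independent runs.\<close>
  also have "\<dots> =
    do {x0 \<leftarrow> replicate_pmf r P0; v0 \<leftarrow> T Q0 x0; x1 \<leftarrow> replicate_pmf r P1; v1 \<leftarrow> T Q1 x1;
        return_pmf (if v0 = Reject \<or> v1 = Reject then Reject else Accept)}"
    by (subst bind_commute_pmf) (rule refl)
  finally show ?thesis
    by (simp add: run_identity_def map_pmf_def pair_pmf_def bind_assoc_pmf bind_return_pmf)
qed

lemma pmf_run_fi_procedure_Accept:
  assumes "aDP \<epsilon> \<delta> Q0 Q1"
  shows "pmf (run_fi r (fi_procedure \<epsilon> \<delta> T) Q0 Q1 P0 P1) Accept =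
    pmf (run_identity r T Q0 P0) Accept * pmf (run_identity r T Q1 P1) Accept"
proof -
  have "(\<lambda>(v0, v1). if v0 = Reject \<or> v1 = Reject then Reject else Accept) -` {Accept} = {(Accept, Accept)}"
    by (auto split: if_splits) (metis verdict.exhaust)+
  then show ?thesis
    unfolding run_fi_procedure_aDP[OF assms] pmf_map by (simp add: measure_pmf_single pmf_pair)
qed

lemma run_fi_procedure_not_aDP:
  assumes "\<not> aDP \<epsilon> \<delta> Q0 Q1"
  shows "run_fi r (fi_procedure \<epsilon> \<delta> T) Q0 Q1 P0 P1 = return_pmf Reject"
  using assms by (simp add: run_fi_def fi_procedure_def)

text \<open>Replacing the distribution on the left of an aDP inequality costs at most t, and the one
  on the right at most exp \<epsilon> times t, where t is the larger distance.\<close>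

lemma aDP_diff:
  assumes "aDP \<epsilon> \<delta> Q0 Q1"
  shows "aDP \<epsilon> (\<delta> + (1 + exp \<epsilon>) * max (tv_dist Q0 P0) (tv_dist Q1 P1)) P0 P1"
  unfolding aDP_def
proof (intro allI conjI)
  fix E
  define t where "t = max (tv_dist Q0 P0) (tv_dist Q1 P1)"
  have d: "\<bar>measure_pmf.prob Q0 E - measure_pmf.prob P0 E\<bar> \<le> t"
    "\<bar>measure_pmf.prob Q1 E - measure_pmf.prob P1 E\<bar> \<le> t"
    using prob_diff_le_tv_dist[of Q0 E P0] prob_diff_le_tv_dist[of Q1 E P1] by (auto simp: t_def)
  then have "exp \<epsilon> * measure_pmf.prob Q0 E \<le> exp \<epsilon> * (measure_pmf.prob P0 E + t)"
    "exp \<epsilon> * measure_pmf.prob Q1 E \<le> exp \<epsilon> * (measure_pmf.prob P1 E + t)"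
    by (auto intro!: mult_left_mono)
  moreover have "measure_pmf.prob Q0 E \<le> exp \<epsilon> * measure_pmf.prob Q1 E + \<delta>"
    "measure_pmf.prob Q1 E \<le> exp \<epsilon> * measure_pmf.prob Q0 E + \<delta>"
    using assms by (auto simp: aDP_def)
  ultimately show "measure_pmf.prob P0 E \<le> exp \<epsilon> * measure_pmf.prob P1 E + (\<delta> + (1 + exp \<epsilon>) * t)"
    "measure_pmf.prob P1 E \<le> exp \<epsilon> * measure_pmf.prob P0 E + (\<delta> + (1 + exp \<epsilon>) * t)"
    using d by (auto simp: algebra_simps abs_le_iff)
qed

lemma far_from_aDP_imp_tv_dist:
  assumes "far_from_aDP \<alpha> \<epsilon> \<delta> P0 P1" "aDP \<epsilon> \<delta> Q0 Q1"
  shows "tv_dist Q0 P0 > \<alpha> / (1 + exp \<epsilon>) \<or> tv_dist Q1 P1 > \<alpha> / (1 + exp \<epsilon>)"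
proof -
  define t where "t = max (tv_dist Q0 P0) (tv_dist Q1 P1)"
  have "t \<ge> 0"
    using tv_dist_nonneg[of Q0 P0] by (simp add: t_def)
  moreover have "\<bar>(\<delta> + (1 + exp \<epsilon>) * t) - \<delta>\<bar> > \<alpha>"
    using assms aDP_diff[of \<epsilon> \<delta> Q0 Q1 P0 P1] by (auto simp: far_from_aDP_def t_def)
  ultimately have "\<alpha> < (1 + exp \<epsilon>) * t"
    by simp
  then have "\<alpha> / (1 + exp \<epsilon>) < t"
    by (simp add: divide_less_eq add_pos_pos mult.commute)
  then show ?thesis
    by (auto simp: t_def)
qed

lemma not_far_from_aDP_if_gt_1:
  assumes "\<alpha> > 1" "\<delta> > 0"
  shows "\<not> far_from_aDP \<alpha> \<epsilon> \<delta> P0 P1"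
proof
  assume far: "far_from_aDP \<alpha> \<epsilon> \<delta> P0 P1"
  \<comment> \<open>A slack of at least 1 makes every pair aDP, and this one differs from \<delta>
    by less than 1.\<close>
  define \<delta>' where "\<delta>' = max 1 \<delta>"
  have "measure_pmf.prob P E \<le> exp \<epsilon> * measure_pmf.prob P' E + \<delta>'" for P P' :: "'a pmf" and E
  proof -
    have "0 \<le> exp \<epsilon> * measure_pmf.prob P' E" "1 \<le> \<delta>'"
      by (simp_all add: \<delta>'_def)
    then show ?thesis
      using measure_pmf.prob_le_1[of P E] by linarith
  qed
  then have "\<bar>\<delta>' - \<delta>\<bar> > \<alpha>"
    using far by (simp add: far_from_aDP_def aDP_def)
  with assms show False
    by (auto simp: \<delta>'_def max_def split: if_splits)
qed

text \<open>The two error requirements differ because acceptance needs both runs to accept, and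
  (5/6)^2 = 25/36 \<ge> 2/3, whereas a single rejecting run suffices for rejection.\<close>

lemma fi_aDP_tester_fi_procedure:
  assumes complete: "\<And>P. dist_on n P \<Longrightarrow> pmf (run_identity r T P P) Accept \<ge> 5/6"
    and sound: "\<And>P Q. dist_on n P \<Longrightarrow> dist_on n Q \<Longrightarrow> tv_dist P Q \<ge> \<alpha> / (1 + exp \<epsilon>) \<Longrightarrow>
      pmf (run_identity r T P Q) Reject \<ge> 2/3"
  shows "fi_aDP_tester n \<epsilon> \<delta> \<alpha> r (fi_procedure \<epsilon> \<delta> T)"
  unfolding fi_aDP_tester_def
proof (intro allI impI conjI)
  fix Q0 Q1 P0 P1
  assume dist: "dist_on n Q0" "dist_on n Q1" "dist_on n P0" "dist_on n P1"
  let ?run = "run_fi r (fi_procedure \<epsilon> \<delta> T) Q0 Q1 P0 P1"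
  {
    assume *: "aDP \<epsilon> \<delta> P0 P1 \<and> P0 = Q0 \<and> P1 = Q1"
    have "(5/6) * (5/6) \<le> pmf (run_identity r T Q0 Q0) Accept * pmf (run_identity r T Q1 Q1) Accept"
      by (intro mult_mono complete dist) auto
    moreover have "aDP \<epsilon> \<delta> Q0 Q1"
      using * by auto
    ultimately show "pmf ?run Accept \<ge> 2/3"
      using * by (simp add: pmf_run_fi_procedure_Accept)
  next
    assume far: "far_from_aDP \<alpha> \<epsilon> \<delta> P0 P1"
    show "pmf ?run Reject \<ge> 2/3"
    proof (cases "aDP \<epsilon> \<delta> Q0 Q1")
      case True
      let ?a0 = "pmf (run_identity r T Q0 P0) Accept" and ?a1 = "pmf (run_identity r T Q1 P1) Accept"
      have "pmf ?run Accept \<le> ?a0" "pmf ?run Accept \<le> ?a1"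
        unfolding pmf_run_fi_procedure_Accept[OF True]
        by (auto intro!: mult_left_le mult_left_le_one_le pmf_le_1)
      moreover have "?a0 \<le> 1/3 \<or> ?a1 \<le> 1/3"
        using far_from_aDP_imp_tv_dist[OF far True] sound[of Q0 P0] sound[of Q1 P1] dist
        by (auto simp: pmf_verdict_Reject)
      ultimately show ?thesis
        unfolding pmf_verdict_Reject by linarith
    qed (simp add: run_fi_procedure_not_aDP)
  }
qed

section \<open>The range \<alpha> > 1 and the final sample bound\<close>

lemma identity_tester_trivial:
  assumes "\<alpha> > 1"
  shows "identity_tester n \<alpha> 0 (\<lambda>P xs. return_pmf Accept)"
proof -
  have "\<not> tv_dist P Q \<ge> \<alpha>" for P Q :: "nat pmf"
    using tv_dist_le_1[of P Q] assms by linarith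
  then show ?thesis
    by (simp add: identity_tester_def run_identity_def bind_return_pmf)
qed

lemma fi_aDP_tester_trivial:
  assumes "\<alpha> > 1" "\<delta> > 0"
  shows "fi_aDP_tester n \<epsilon> \<delta> \<alpha> 0 (fi_procedure \<epsilon> \<delta> (\<lambda>P xs. return_pmf Accept))"
  using not_far_from_aDP_if_gt_1[OF assms]
  by (auto simp: fi_aDP_tester_def pmf_run_fi_procedure_Accept run_identity_def bind_return_pmf)

text \<open>The constant hidden in the O-notation is fixed before \<delta>, \<alpha> and n, so it
  depends on \<epsilon> alone.\<close>

theorem proposition16:
  fixes \<epsilon> :: real
  assumes "\<epsilon> > 0"
  shows "\<exists>C>0. \<forall>\<delta>>0. \<forall>\<alpha>>0.
           \<exists>(T :: nat \<Rightarrow> identity_alg) (r :: nat \<Rightarrow> nat). \<forall>n\<ge>1.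
             identity_tester n \<alpha> (r n) (T n) \<and>
             fi_aDP_tester n \<epsilon> \<delta> \<alpha> (r n) (fi_procedure \<epsilon> \<delta> (T n)) \<and>
             real (r n) \<le> C * (sqrt (real n) / \<alpha>\<^sup>2)"
proof (intro exI[of _ "2002 * (1 + exp \<epsilon>)\<^sup>2"] conjI allI impI)
  have e: "1 + exp \<epsilon> > 1"
    by simp
  then have ne: "1 + exp \<epsilon> \<noteq> 0"
    by (metis not_one_less_zero)
  then show "2002 * (1 + exp \<epsilon>)\<^sup>2 > 0"
    by (simp add: add_pos_pos)
  fix \<delta> \<alpha> :: real
  assume \<delta>: "\<delta> > 0" and \<alpha>: "\<alpha> > 0"
  show "\<exists>(T :: nat \<Rightarrow> identity_alg) (r :: nat \<Rightarrow> nat). \<forall>n\<ge>1.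
             identity_tester n \<alpha> (r n) (T n) \<and>
             fi_aDP_tester n \<epsilon> \<delta> \<alpha> (r n) (fi_procedure \<epsilon> \<delta> (T n)) \<and>
             real (r n) \<le> 2002 * (1 + exp \<epsilon>)\<^sup>2 * (sqrt (real n) / \<alpha>\<^sup>2)"
  proof (cases "\<alpha> > 1")
    case True
    then show ?thesis
      using \<delta> by (intro exI[of _ "\<lambda>n P xs. return_pmf Accept"] exI[of _ "\<lambda>n. 0"])
        (auto simp: identity_tester_trivial fi_aDP_tester_trivial)
  next
    case False
    \<comment> \<open>The tester runs at the proximity that \<open>far_from_aDP_imp_tv_dist\<close>
      guarantees for one of the two databases; as a \<le> \<alpha>, it is also an identity tester at
      \<alpha>.\<close>
    define a where "a = \<alpha> / (1 + exp \<epsilon>)"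
    have a0: "a > 0"
      using \<alpha> by (simp add: a_def add_pos_pos)
    have "a * 1 \<le> a * (1 + exp \<epsilon>)"
      using a0 e by (intro mult_left_mono) auto
    also have "\<dots> = \<alpha>"
      by (simp add: a_def ne)
    finally have a: "a > 0" "a \<le> \<alpha>" "a \<le> 1"
      using a0 False by auto
    define m where "m = (\<lambda>n::nat. nat \<lceil>1000 * sqrt (real n) / a\<^sup>2\<rceil>)"
    have "identity_tester n \<alpha> (2 * m n) (chi_tester n a (m n)) \<and>
          fi_aDP_tester n \<epsilon> \<delta> \<alpha> (2 * m n) (fi_procedure \<epsilon> \<delta> (chi_tester n a (m n))) \<and>
          real (2 * m n) \<le> 2002 * (1 + exp \<epsilon>)\<^sup>2 * (sqrt (real n) / \<alpha>\<^sup>2)"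
      if n: "n \<ge> 1" for n
    proof (intro conjI)
      have m: "real (m n) \<ge> 1000 * sqrt (real n) / a\<^sup>2"
        unfolding m_def by (rule real_nat_ceiling_ge)
      note complete = chi_tester_complete[OF n _ a(1) m]
      note sound = chi_tester_sound[OF n _ _ a(1,3) m]
      have sound': "pmf (run_identity (2 * m n) (chi_tester n a (m n)) P Q) Reject \<ge> 2/3"
        if "dist_on n P" "dist_on n Q" "tv_dist P Q \<ge> a" for P Q
        using sound[OF that] by simp
      show "identity_tester n \<alpha> (2 * m n) (chi_tester n a (m n))"
        unfolding identity_tester_def
      proof (intro allI impI conjI)
        fix P Q
        assume dist: "dist_on n P" "dist_on n Q"
        show "pmf (run_identity (2 * m n) (chi_tester n a (m n)) P Q) Accept \<ge> 2/3" if "P = Q"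
          using complete[OF dist(1)] that by simp
        show "pmf (run_identity (2 * m n) (chi_tester n a (m n)) P Q) Reject \<ge> 2/3"
          if "tv_dist P Q \<ge> \<alpha>"
          using sound'[OF dist] that a by simp
      qed
      show "fi_aDP_tester n \<epsilon> \<delta> \<alpha> (2 * m n) (fi_procedure \<epsilon> \<delta> (chi_tester n a (m n)))"
        using complete sound' by (intro fi_aDP_tester_fi_procedure) (auto simp: a_def)
      \<comment> \<open>Rounding up costs at most 1, which is at most sqrt n / a^2; hence m \<le>
        1001 sqrt n / a^2, and two blocks give 2002. Expressing a through \<alpha> produces the
        factor (1 + exp \<epsilon>)^2.\<close>
      have "a\<^sup>2 \<le> 1"
        using a by (simp add: power_le_one)
      moreover have "sqrt (real n) \<ge> 1"
        using n by simp
      ultimately have "a\<^sup>2 \<le> sqrt (real n)"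
        by (rule order_trans)
      then have "sqrt (real n) / a\<^sup>2 \<ge> 1"
        using a by (simp add: le_divide_eq)
      moreover have "real (m n) \<le> 1000 * (sqrt (real n) / a\<^sup>2) + 1"
        unfolding m_def using a by (simp add: of_nat_ceiling)
      ultimately have "real (2 * m n) \<le> 2002 * (sqrt (real n) / a\<^sup>2)"
        by simp
      also have "\<dots> = 2002 * (1 + exp \<epsilon>)\<^sup>2 * (sqrt (real n) / \<alpha>\<^sup>2)"
        by (simp add: a_def power_divide ne)
      finally show "real (2 * m n) \<le> \<dots>" .
    qed
    then show ?thesis
      by (intro exI[of _ "\<lambda>n. chi_tester n a (m n)"] exI[of _ "\<lambda>n. 2 * m n"]) simp
  qed
qed

end
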